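(* Let $T$ be a finite tree of order at least $3$. Then $T$ is $3$-critical with $\mathrm{sd}(T)=3$ if and only if $T$ is isomorphic to the path $P_{3k+1}$ for some integer $k\ge 1$.
   Context: All graphs are finite and simple; $P_n$ is the path on $n$ vertices. A set $D\subseteq V(G)$ is dominating if every vertex of $V(G)\setminus D$ has a neighbour in $D$; $\gamma(G)$ is the minimum cardinality of a dominating set of $G$. For $F\subseteq E(G)$, $G_F$ denotes the graph obtained from $G$ by subdividing each edge of $F$ exactly once (each edge $uv\in F$ is replaced by a path $u,w,v$ with a new vertex $w$). For an integer $q\ge 1$, a connected graph $G$ of order at least $3$ is called $q$-critical ($\gamma$-$q$-critical) if $\gamma(G_F)>\gamma(G)$ for every $F\subseteq E(G)$ with $|F|=q$, and there is a set $F'\subseteq E(G)$ with $|F'|=q-1$ such that $\gamma(G_{F'})=\gamma(G)$. The domination subdivision number $\mathrm{sd}(G)$ is the minimum cardinality of a set $F\subseteq E(G)$ such that $\gamma(G_F)>\gamma(G)$. *)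

theory Defs
  imports "Graph_Theory.Graph_Theory"
begin

text \<open>
  A finite simple graph is a \<^locale>\<open>pair_graph\<close>: a finite, loop-free, symmetric relation
  \<^term>\<open>parcs G\<close> on a vertex set \<^term>\<open>pverts G\<close>. An undirected edge is thus
  a pair of opposite arcs; to count edges correctly we represent it by its set of end vertices.
\<close>

definition edges :: "'a pair_pre_digraph \<Rightarrow> 'a set set" where
  "edges G = {{u, v} | u v. (u, v) \<in> parcs G}"

text \<open>
  The library's \<^const>\<open>tree\<close> is not usable for symmetric digraphs: it counts the walk from
  \<open>u\<close> to \<open>v\<close> and back along an edge as a cycle. Hence the bound on the length.
\<close>

definition undirected_tree :: "'a pair_pre_digraph \<Rightarrow> bool" where
  "undirected_tree G \<longleftrightarrow> pair_graph G \<and> connected (with_proj G) \<and>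
     \<not> (\<exists>p. pre_digraph.cycle (with_proj G) p \<and> length p \<ge> 3)"

definition path_graph :: "nat \<Rightarrow> nat pair_pre_digraph" where
  "path_graph n = \<lparr> pverts = {..<n},
     parcs = {(i, j). i < n \<and> j < n \<and> (j = Suc i \<or> i = Suc j)} \<rparr>"

definition dominating :: "'a pair_pre_digraph \<Rightarrow> 'a set \<Rightarrow> bool" where
  "dominating G D \<longleftrightarrow> D \<subseteq> pverts G \<and> (\<forall>v \<in> pverts G - D. \<exists>u \<in> D. (v, u) \<in> parcs G)"

definition domination_number :: "'a pair_pre_digraph \<Rightarrow> nat" where
  "domination_number G = Inf {card D | D. dominating G D}"

text \<open>
  In \<open>subdivided G F\<close>, the old vertices are tagged with \<^const>\<open>Inl\<close>, and the new vertex
  subdividing an edge \<open>e \<in> F\<close> is \<open>Inr e\<close>. Intended for \<open>F \<subseteq> edges G\<close>.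
\<close>

definition subdivided :: "'a pair_pre_digraph \<Rightarrow> 'a set set \<Rightarrow> ('a + 'a set) pair_pre_digraph" where
  "subdivided G F = \<lparr> pverts = Inl ` pverts G \<union> Inr ` F,
     parcs = {(Inl u, Inl v) | u v. (u, v) \<in> parcs G \<and> {u, v} \<notin> F}
       \<union> {(Inl u, Inr e) | u e. e \<in> F \<and> u \<in> e}
       \<union> {(Inr e, Inl u) | u e. e \<in> F \<and> u \<in> e} \<rparr>"

definition critical :: "nat \<Rightarrow> 'a pair_pre_digraph \<Rightarrow> bool" where
  "critical q G \<longleftrightarrow> q \<ge> 1 \<and> pair_graph G \<and> connected (with_proj G) \<and> card (pverts G) \<ge> 3 \<and>
     (\<forall>F \<subseteq> edges G. card F = q \<longrightarrow> domination_number (subdivided G F) > domination_number G) \<and>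
     (\<exists>F' \<subseteq> edges G. card F' = q - 1 \<and> domination_number (subdivided G F') = domination_number G)"

text \<open>
  The infimum on \<^typ>\<open>nat\<close> is the least element of a nonempty set, and is \<open>0\<close> for the empty
  set; so a positive value of \<open>sd G\<close> is always attained.
\<close>

definition sd :: "'a pair_pre_digraph \<Rightarrow> nat" where
  "sd G = Inf {card F | F. F \<subseteq> edges G \<and>
     domination_number (subdivided G F) > domination_number G}"

lemma pair_graph_path_graph: "pair_graph (path_graph n)"
proof -
  have "finite (parcs (path_graph n))"
    by (rule finite_subset[of _ "{..<n} \<times> {..<n}"]) (auto simp: path_graph_def)
  then show ?thesis
    by unfold_locales
      (auto simp: path_graph_def symmetric_def arcs_ends_def arc_to_ends_def sym_def)
qed

lemma pair_graph_subdivided: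
  assumes "pair_graph G" "F \<subseteq> edges G"
  shows "pair_graph (subdivided G F)"
proof -
  interpret pair_graph G by fact
  have sym: "(v, u) \<in> parcs G" if "(u, v) \<in> parcs G" for u v
    using pair_sym_arcs that by (auto simp: symmetric_def arcs_ends_def arc_to_ends_def sym_def)
  have endV: "u \<in> pverts G" "v \<in> pverts G" if "(u, v) \<in> parcs G" for u v
    using arc_fst_in_verts[OF that] arc_snd_in_verts[OF that] by simp_all
  have inV: "u \<in> pverts G" if "e \<in> F" "u \<in> e" for u e
  proof -
    obtain a b where "e = {a, b}" "(a, b) \<in> parcs G"
      using \<open>e \<in> F\<close> assms(2) by (auto simp: edges_def)
    then show ?thesis
      using \<open>u \<in> e\<close> endV by auto
  qed
  have "edges G = (\<lambda>(u, v). {u, v}) ` parcs G"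
    by (auto simp: edges_def)
  then have "finite F"
    using assms(2) pair_finite_arcs finite_subset by fastforce
  then have finV: "finite (pverts (subdivided G F))"
    using pair_finite_verts by (simp add: subdivided_def)
  have arcs: "parcs (subdivided G F) \<subseteq> pverts (subdivided G F) \<times> pverts (subdivided G F)"
    using inV endV by (auto simp: subdivided_def)
  have finE: "finite (parcs (subdivided G F))"
    using arcs finV finite_subset by fastforce
  have loop: "fst a \<noteq> snd a" if "a \<in> parcs (subdivided G F)" for a
    using that pair_no_loops by (fastforce simp: subdivided_def)
  have "symmetric (with_proj (subdivided G F))"
    using sym by (auto simp: symmetric_def arcs_ends_def arc_to_ends_def sym_def
        subdivided_def insert_commute)
  then show ?thesis
    using arcs finV finE loop by unfold_locales auto
qed

lemma digraph_iso_with_proj_iff: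
  assumes "pair_wf_digraph G"
  shows "digraph_iso (with_proj G) (with_proj H) \<longleftrightarrow>
    (\<exists>f. bij_betw f (pverts G) (pverts H) \<and> map_prod f f ` parcs G = parcs H)"
proof
  interpret pair_wf_digraph G by fact
  assume "digraph_iso (with_proj G) (with_proj H)"
  then obtain h where h: "digraph_isomorphism h" "with_proj H = app_iso h (with_proj G)"
    by (auto simp: digraph_iso_def)
  have H: "pverts H = iso_verts h ` pverts G" "parcs H = iso_arcs h ` parcs G"
    "fst = iso_tail h" "snd = iso_head h"
    using h(2) by (simp_all add: app_iso_def with_proj_def)
  have "iso_arcs h a = map_prod (iso_verts h) (iso_verts h) a" if "a \<in> parcs G" for a
    using h(1) that by (cases a) (auto simp: digraph_isomorphism_def H(3,4)[symmetric] prod_eq_iff)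
  then show "\<exists>f. bij_betw f (pverts G) (pverts H) \<and> map_prod f f ` parcs G = parcs H"
    using h(1) H by (auto simp: digraph_isomorphism_def bij_betw_def intro!: exI[of _ "iso_verts h"])
next
  interpret pair_wf_digraph G by fact
  assume "\<exists>f. bij_betw f (pverts G) (pverts H) \<and> map_prod f f ` parcs G = parcs H"
  then obtain f where f: "inj_on f (pverts G)" "f ` pverts G = pverts H"
    "map_prod f f ` parcs G = parcs H"
    by (auto simp: bij_betw_def)
  define h where "h = \<lparr> iso_verts = f, iso_arcs = map_prod f f, iso_head = snd, iso_tail = fst \<rparr>"
  have "parcs G \<subseteq> pverts G \<times> pverts G"
    using arc_fst_in_verts arc_snd_in_verts by (metis mem_Times_iff subsetI)
  then have "inj_on (map_prod f f) (parcs G)"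
    using map_prod_inj_on[OF f(1) f(1)] inj_on_subset by blast
  then have "digraph_isomorphism h"
    using f(1) wf_digraph by (auto simp: digraph_isomorphism_def h_def)
  moreover have "with_proj H = app_iso h (with_proj G)"
    using f by (simp add: app_iso_def h_def with_proj_def)
  ultimately show "digraph_iso (with_proj G) (with_proj H)"
    by (auto simp: digraph_iso_def)
qed

end

theory Submission
  imports Defs
begin

text \<open>
  In a tree, \<open>\<gamma>\<close> is the maximum size of a packing, i.e. of a set of vertices with pairwise
  disjoint closed neighbourhoods. Suppose that subdividing at most two edges never raises \<open>\<gamma>\<close>. If
  some vertex \<open>v\<close> with a neighbour \<open>y\<close> were outside all closed neighbourhoods of a maximum packing
  \<open>S\<close>, then subdividing \<open>vy\<close> and the edge from \<open>y\<close> to its neighbour in \<open>S\<close> (if any) would make room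
  for one more element; so \<open>S\<close> is a perfect code, and it contains all leaves. From \<open>S\<close> one obtains
  a dominating set of size \<open>card S\<close> after subdividing all edges at a given vertex. Hence, if
  subdividing three edges always raises \<open>\<gamma>\<close>, there is no vertex of degree at least three and the
  tree is a path. On a path with \<open>n\<close> vertices \<open>\<gamma>\<close> is \<open>n / 3\<close> rounded up, and the subdivision of
  \<open>m\<close> edges is a path with \<open>n + m\<close> vertices, so only \<open>n mod 3 = 1\<close> survives.
\<close>

section \<open>Dominating sets and packings\<close>

definition closed_nbhd :: "'a pair_pre_digraph \<Rightarrow> 'a \<Rightarrow> 'a set" where
  "closed_nbhd G v = insert v {u. (v, u) \<in> parcs G}"

definition packing :: "'a pair_pre_digraph \<Rightarrow> 'a set \<Rightarrow> bool" where
  "packing G P \<longleftrightarrow> P \<subseteq> pverts G \<and>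
     (\<forall>p\<in>P. \<forall>q\<in>P. p \<noteq> q \<longrightarrow> closed_nbhd G p \<inter> closed_nbhd G q = {})"

text \<open>Smaller sets are included because the sets subdivided later have one or two edges,
  depending on the position of the packing.\<close>

definition stable_under :: "nat \<Rightarrow> 'a pair_pre_digraph \<Rightarrow> bool" where
  "stable_under q G \<longleftrightarrow> (\<forall>F \<subseteq> edges G. card F \<le> q \<longrightarrow>
     domination_number (subdivided G F) \<le> domination_number G)"

lemma mem_closed_nbhd: "u \<in> closed_nbhd G v \<longleftrightarrow> u = v \<or> (v, u) \<in> parcs G"
  by (auto simp: closed_nbhd_def)

lemma dominating_iff:
  "dominating G D \<longleftrightarrow> D \<subseteq> pverts G \<and> (\<forall>v\<in>pverts G. closed_nbhd G v \<inter> D \<noteq> {})"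
  unfolding dominating_def closed_nbhd_def by blast

lemma domination_number_le: "dominating G D \<Longrightarrow> domination_number G \<le> card D"
  unfolding domination_number_def by (rule cInf_lower) auto

lemma domination_number_attained:
  obtains D where "dominating G D" "card D = domination_number G"
proof -
  \<comment> \<open>The whole vertex set dominates, so the infimum ranges over a nonempty set and is
    a minimum, not the default 0.\<close>
  have "dominating G (pverts G)" by (auto simp: dominating_def)
  then have "{card D | D. dominating G D} \<noteq> {}" by blast
  from Inf_nat_def1[OF this] show ?thesis
    unfolding domination_number_def[symmetric] using that by auto
qed

context pair_graph
begin

lemma arcs_sym: "(u, v) \<in> parcs G \<Longrightarrow> (v, u) \<in> parcs G"
  using pair_sym_arcs by (auto simp: symmetric_def arcs_ends_def arc_to_ends_def sym_def)

lemma closed_nbhd_sym: "u \<in> closed_nbhd G v \<longleftrightarrow> v \<in> closed_nbhd G u"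
  by (auto simp: mem_closed_nbhd dest: arcs_sym)

lemma closed_nbhd_subset: "v \<in> pverts G \<Longrightarrow> closed_nbhd G v \<subseteq> pverts G"
  by (auto simp: closed_nbhd_def dest: wellformed')

lemma finite_closed_nbhd: "v \<in> pverts G \<Longrightarrow> finite (closed_nbhd G v)"
  using closed_nbhd_subset finite_subset pair_finite_verts by blast

lemma packing_unique:
  assumes "packing G P" "p \<in> P" "q \<in> P" "u \<in> closed_nbhd G p" "u \<in> closed_nbhd G q"
  shows "p = q"
  using assms by (auto simp: packing_def)

text \<open>Weak duality: each element of \<open>P\<close> needs a dominator in its own closed
  neighbourhood, and disjointness makes the choice of dominators injective.\<close>

lemma packing_card_le:
  assumes "packing G P" "dominating G D"
  shows "card P \<le> card D"
proof -
  have "\<forall>p\<in>P. \<exists>d. d \<in> D \<and> d \<in> closed_nbhd G p"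
    using assms by (fastforce simp: packing_def dominating_iff)
  then obtain h where h: "\<And>p. p \<in> P \<Longrightarrow> h p \<in> D \<and> h p \<in> closed_nbhd G p" by metis
  have "inj_on h P"
    by (rule inj_onI) (metis h packing_unique[OF assms(1)])
  moreover have "finite D"
    using assms(2) pair_finite_verts finite_subset unfolding dominating_def by blast
  ultimately show ?thesis
    using h by (intro card_inj_on_le) auto
qed

lemma packing_le_domination_number: "packing G P \<Longrightarrow> card P \<le> domination_number G"
  by (metis domination_number_attained packing_card_le)

end

section \<open>Rooted trees\<close>

text \<open>A construction order of a tree: each new vertex is attached as a leaf to the part
  already built.\<close>

definition tree_enum :: "'a pair_pre_digraph \<Rightarrow> (nat \<Rightarrow> 'a) \<Rightarrow> nat \<Rightarrow> bool" where
  "tree_enum G f n \<longleftrightarrow> bij_betw f {..<n} (pverts G) \<and>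
     (\<forall>i. 0 < i \<and> i < n \<longrightarrow> (\<exists>!j. j < i \<and> (f j, f i) \<in> parcs G))"

text \<open>The last clause encodes acyclicity: at most one neighbour of a vertex has smaller
  rank.\<close>

definition rooted :: "'a pair_pre_digraph \<Rightarrow> 'a \<Rightarrow> ('a \<Rightarrow> nat) \<Rightarrow> ('a \<Rightarrow> 'a) \<Rightarrow> bool" where
  "rooted G r rank par \<longleftrightarrow> r \<in> pverts G \<and> inj_on rank (pverts G) \<and> rank r = 0 \<and>
     (\<forall>v\<in>pverts G. v \<noteq> r \<longrightarrow> (par v, v) \<in> parcs G) \<and>
     (\<forall>u v. (u, v) \<in> parcs G \<and> rank u < rank v \<longrightarrow> u = par v)"

context pair_graph
begin

lemma rooted_cases:
  assumes "rooted G r rank par" "(u, v) \<in> parcs G"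
  obtains "rank u < rank v" "u = par v" | "rank v < rank u" "v = par u"
proof -
  have "u \<noteq> v" using assms(2) no_loops' by blast
  then have "rank u \<noteq> rank v"
    using assms wellformed'[OF assms(2)] by (auto simp: rooted_def inj_on_def)
  then show ?thesis
    using assms arcs_sym[OF assms(2)] that by (metis linorder_neqE_nat rooted_def)
qed

text \<open>Greedy: the vertex \<open>x\<close> of \<open>X\<close> last in the order is dominated by its parent, which also
  dominates every other vertex of \<open>X\<close> within distance two of \<open>x\<close>.\<close>
lemma rooted_dominating_packing:
  assumes "rooted G r rank par" "X \<subseteq> pverts G"
  shows "\<exists>D P. D \<subseteq> pverts G \<and> P \<subseteq> X \<and> card D \<le> card P \<and> packing G P \<and>
    (\<forall>v\<in>X. closed_nbhd G v \<inter> D \<noteq> {})"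
  using assms(2)
proof (induction "card X" arbitrary: X rule: less_induct)
  case less
  have finX: "finite X" using less.prems pair_finite_verts finite_subset by blast
  show ?case
  proof (cases "X = {}")
    case True
    then show ?thesis
      by (intro exI[of _ "{}"]) (auto simp: packing_def)
  next
    case False
    then obtain x where x: "x \<in> X" "\<And>y. y \<in> X \<Longrightarrow> rank y \<le> rank x"
      using finX Max_in[of "rank ` X"] Max_ge[of "rank ` X"] by (metis (no_types, lifting) finite_imageI image_iff image_is_empty)
    have xV: "x \<in> pverts G" using x less.prems by auto
    \<comment> \<open>The greedy centre. The root has no parent and dominates itself.\<close>
    define p where "p = (if x = r then x else par x)"
    have p: "x \<in> closed_nbhd G p" "p \<in> pverts G"
      using assms(1) xV by (auto simp: p_def mem_closed_nbhd rooted_def dest: wellformed')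
    define X' where "X' = X - closed_nbhd G p"
    have "card X' < card X"
      using x p finX by (auto simp: X'_def intro!: psubset_card_mono)
    moreover have "X' \<subseteq> pverts G" using less.prems by (auto simp: X'_def)
    ultimately obtain D P where IH: "D \<subseteq> pverts G" "P \<subseteq> X'" "card D \<le> card P" "packing G P"
      "\<forall>v\<in>X'. closed_nbhd G v \<inter> D \<noteq> {}"
      using less.hyps[of X'] by auto
    have lt: "par y = z" if "(z, y) \<in> parcs G" "rank z < rank y" for z y
      using assms(1) that unfolding rooted_def by blast
    have par_x: "z = p" if "(z, x) \<in> parcs G" "rank z < rank x" for z
    proof -
      have "x \<noteq> r" using that assms(1) by (auto simp: rooted_def)
      then show ?thesis using lt[OF that] by (simp add: p_def)
    qed
    have disj: "closed_nbhd G z \<inter> closed_nbhd G x = {}" if "z \<in> P" for z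
    proof (rule ccontr)
      assume "closed_nbhd G z \<inter> closed_nbhd G x \<noteq> {}"
      then obtain w where w: "w \<in> closed_nbhd G z" "w \<in> closed_nbhd G x" by blast
      have z: "z \<in> X" "z \<notin> closed_nbhd G p" using that IH by (auto simp: X'_def)
      then have "z \<noteq> x" using p by auto
      then have zx: "rank z < rank x"
        using x z xV less.prems assms(1)
        by (metis inj_onD order_le_imp_less_or_eq rooted_def subsetD)
      have zp: "z \<noteq> p" "(p, z) \<notin> parcs G" "(z, p) \<notin> parcs G"
        using z arcs_sym by (auto simp: mem_closed_nbhd)
      have nzx: "(z, x) \<notin> parcs G" using par_x zx zp by blast
      have "w \<noteq> x" using w(1) nzx \<open>z \<noteq> x\<close> by (auto simp: mem_closed_nbhd)
      then have xw: "(x, w) \<in> parcs G" using w by (auto simp: mem_closed_nbhd)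
      have "w \<noteq> z" using nzx xw arcs_sym by blast
      then have zw: "(z, w) \<in> parcs G" using w by (auto simp: mem_closed_nbhd)
      \<comment> \<open>A common neighbour \<open>w\<close> after \<open>x\<close> would have two
        parents \<open>x\<close> and \<open>z\<close>; before \<open>x\<close> it is
        \<open>p\<close>, and then \<open>z\<close> was removed together with the neighbourhood of
        \<open>p\<close>.\<close>
      show False
      proof (cases rule: rooted_cases[OF assms(1) xw])
        case 1
        then show ?thesis using lt[OF zw] zx \<open>z \<noteq> x\<close> by auto
      next
        case 2
        then show ?thesis using par_x[OF arcs_sym[OF xw]] zw zp by auto
      qed
    qed
    have "packing G (insert x P)"
      using IH(4) disj xV unfolding packing_def by blast
    moreover have "card (insert p D) \<le> card (insert x P)"
    proof -
      have "x \<notin> P" using IH(2) p(1) closed_nbhd_sym by (auto simp: X'_def)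
      moreover have "finite P" using IH(2) finX finite_subset by (auto simp: X'_def)
      ultimately show ?thesis using IH(3) card_insert_le_m1[of "card D + 1" D p] by simp
    qed
    moreover have "\<forall>v\<in>X. closed_nbhd G v \<inter> insert p D \<noteq> {}"
      using IH(5) closed_nbhd_sym by (fastforce simp: X'_def)
    moreover have "insert p D \<subseteq> pverts G" "insert x P \<subseteq> X"
      using IH p x by (auto simp: X'_def)
    ultimately show ?thesis by blast
  qed
qed

text \<open>With \<open>X\<close> the whole vertex set, the greedy \<open>D\<close> dominates, so
  \<gamma> \<le> \<open>card D\<close> \<le> \<open>card P\<close> \<le> \<gamma>.\<close>

lemma rooted_packing_eq_domination_number:
  assumes "rooted G r rank par"
  obtains P where "packing G P" "card P = domination_number G"
proof -
  obtain D P where "D \<subseteq> pverts G" "card D \<le> card P" "packing G P"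
    "\<forall>v\<in>pverts G. closed_nbhd G v \<inter> D \<noteq> {}"
    using rooted_dominating_packing[OF assms order_refl] by blast
  then show ?thesis
    using that packing_le_domination_number[of P] domination_number_le[of G D]
    by (force simp: dominating_iff)
qed

text \<open>The rank is the position in the enumeration and the parent is the unique earlier
  neighbour.\<close>

lemma tree_enum_rooted:
  assumes "tree_enum G f n" "0 < n"
  obtains rank par where "rooted G (f 0) rank par"
proof -
  have inj: "inj_on f {..<n}" and V: "pverts G = f ` {..<n}"
    using assms by (auto simp: tree_enum_def bij_betw_def)
  define rank where "rank = inv_into {..<n} f"
  define par where "par v = f (THE j. j < rank v \<and> (f j, v) \<in> parcs G)" for v
  have rank: "rank (f i) = i" if "i < n" for i
    using inj that by (simp add: rank_def)
  have ex1: "\<exists>!j. j < i \<and> (f j, f i) \<in> parcs G" if "0 < i" "i < n" for i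
    using assms that by (auto simp: tree_enum_def)
  have "(par v, v) \<in> parcs G" if v: "v \<in> pverts G" "v \<noteq> f 0" for v
  proof -
    obtain i where i: "i < n" "v = f i" using v V by auto
    then have "0 < i" using v by (cases i) auto
    from theI'[OF ex1[OF this i(1)]] show ?thesis using i rank by (simp add: par_def)
  qed
  moreover have "u = par v" if uv: "(u, v) \<in> parcs G" "rank u < rank v" for u v
  proof -
    obtain i j where ij: "i < n" "v = f i" "j < n" "u = f j"
      using wellformed'[OF uv(1)] V by auto
    then have "j < i" using uv rank by auto
    with ij uv have "(THE j. j < i \<and> (f j, f i) \<in> parcs G) = j"
      by (intro the1_equality ex1) auto
    then show ?thesis using ij rank by (simp add: par_def)
  qed
  moreover have "inj_on rank (pverts G)"
    using rank V by (auto simp: inj_on_def)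
  ultimately show ?thesis
    using that[of rank par] assms(2) V rank by (auto simp: rooted_def)
qed

section \<open>Enumerating the vertices of a tree\<close>

lemma connected_boundary_arc:
  assumes "connected (with_proj G)" "a \<in> U" "U \<subseteq> pverts G" "b \<in> pverts G" "b \<notin> U"
  obtains u x where "u \<in> U" "x \<in> pverts G" "x \<notin> U" "(u, x) \<in> parcs G"
proof -
  \<comment> \<open>\<open>connected\<close> refers to the symmetric closure, which adds no arc to a
    symmetric graph.\<close>
  have sub: "parcs (mk_symmetric (with_proj G)) \<subseteq> parcs G"
    by (auto simp: mk_symmetric_def dest: arcs_sym)
  have "a \<rightarrow>\<^sup>*\<^bsub>with_proj (mk_symmetric (with_proj G))\<^esub> b"
    using assms by (auto simp: connected_def strongly_connected_def mk_symmetric_def)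
  then have "(a, b) \<in> rtrancl_on (pverts G) (parcs (mk_symmetric (with_proj G)))"
    by (simp add: reachable_def mk_symmetric_def)
  then have "b \<notin> U \<longrightarrow> (\<exists>u x. u \<in> U \<and> x \<in> pverts G \<and> x \<notin> U \<and> (u, x) \<in> parcs G)"
  proof (induction rule: rtrancl_on_induct)
    case base
    then show ?case using assms by blast
  next
    case (step y z)
    then show ?case using sub by blast
  qed
  then show ?thesis using that assms by blast
qed

text \<open>Enumerations are grown one vertex at a time; a second earlier neighbour of the new vertex
  would close a cycle with a path inside the part already enumerated.\<close>
lemma undirected_tree_enum:
  assumes "undirected_tree G" "r \<in> pverts G"
  obtains f where "tree_enum G f (card (pverts G))" "f 0 = r"
proof -
  have conn: "connected (with_proj G)" and acyc: "\<And>p. cycle p \<Longrightarrow> length p < 3"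
    using assms by (auto simp: undirected_tree_def not_le)
  \<comment> \<open>The last clause is carried through the induction because it supplies the path,
    inside the enumerated part, that closes the cycle.\<close>
  have "\<exists>f. inj_on f {..<m} \<and> f ` {..<m} \<subseteq> pverts G \<and> f 0 = r \<and>
      (\<forall>i. 0 < i \<and> i < m \<longrightarrow> (\<exists>!j. j < i \<and> (f j, f i) \<in> parcs G)) \<and>
      (\<forall>a\<in>f ` {..<m}. \<forall>b\<in>f ` {..<m}. \<exists>p. apath a p b \<and> set (pawalk_verts a p) \<subseteq> f ` {..<m})"
    if "0 < m" "m \<le> card (pverts G)" for m
    using that
  proof (induction m)
    case 0
    then show ?case by simp
  next
    case (Suc m)
    show ?case
    proof (cases "m = 0")
      case True
      have "apath r [] r" using assms by (simp add: apath_Nil_iff)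
      then show ?thesis
        using assms True by (intro exI[of _ "\<lambda>_. r"]) (auto simp: inj_on_def intro!: exI[of _ "[]"])
    next
      case False
      then have "0 < m" "m \<le> card (pverts G)" using Suc.prems by simp_all
      from Suc.IH[OF this] obtain f where f: "inj_on f {..<m}" "f ` {..<m} \<subseteq> pverts G" "f 0 = r"
        "\<forall>i. 0 < i \<and> i < m \<longrightarrow> (\<exists>!j. j < i \<and> (f j, f i) \<in> parcs G)"
        "\<forall>a\<in>f ` {..<m}. \<forall>b\<in>f ` {..<m}.
          \<exists>p. apath a p b \<and> set (pawalk_verts a p) \<subseteq> f ` {..<m}"
        by (elim exE conjE) (rule that; assumption)
      define U where "U = f ` {..<m}"
      have "card U < card (pverts G)" using f(1) Suc.prems by (simp add: U_def card_image)
      then obtain b where "b \<in> pverts G" "b \<notin> U"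
        using f(2) by (metis U_def nat_neq_iff subsetI subset_antisym)
      moreover have "r \<in> U" using f(3) False by (auto simp: U_def)
      ultimately obtain u x where ux: "u \<in> U" "x \<in> pverts G" "x \<notin> U" "(u, x) \<in> parcs G"
        using connected_boundary_arc[OF conn, of r U b] f(2) unfolding U_def by blast
      have uniq: "u' = u" if u': "u' \<in> U" "(u', x) \<in> parcs G" for u'
      proof (rule ccontr)
        assume ne: "u' \<noteq> u"
        obtain p where p: "apath u p u'" "set (pawalk_verts u p) \<subseteq> U"
          using f(5) ux u' unfolding U_def by blast
        have "awalk x ((x, u) # p @ [(u', x)]) x"
          using p ux u' arcs_sym by (auto simp: apath_def awalk_simps)
        moreover have "distinct (tl (pawalk_verts x ((x, u) # p @ [(u', x)])))"
        proof -
          have "pawalk_verts u (p @ [(u', x)]) = pawalk_verts u p @ [x]"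
            using p(1) by (induction p arbitrary: u) (auto simp: apath_def awalk_simps)
          then show ?thesis using p ux by (auto simp: apath_def)
        qed
        ultimately have "cycle ((x, u) # p @ [(u', x)])"
          unfolding cycle_def by blast
        \<comment> \<open>The two arcs at \<open>x\<close> already use up the length 2 that is
          allowed for walking along an edge and back, so nothing is left for
          \<open>p\<close>.\<close>
        from acyc[OF this] have "p = []" by simp
        then show False using p ne by (simp add: apath_Nil_iff)
      qed
      define g where "g = f(m := x)"
      have g: "g i = f i" if "i < m" for i using that by (simp add: g_def)
      have gm: "g m = x" by (simp add: g_def)
      have gU: "g ` {..<Suc m} = insert x U"
        using g gm by (auto simp: U_def lessThan_Suc)
      have g_inj: "inj_on g {..<Suc m}"
      proof -
        have "inj_on g {..<m}" using f(1) g by (auto simp: inj_on_def)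
        moreover have "g ` {..<m} = U" using g by (auto simp: U_def)
        ultimately show ?thesis using ux(3) gm by (simp add: lessThan_Suc)
      qed
      have g_ex1: "\<exists>!j. j < i \<and> (g j, g i) \<in> parcs G" if i: "0 < i" "i < Suc m" for i
      proof (cases "i = m")
        case True
        obtain j where j: "j < m" "f j = u" using ux by (auto simp: U_def)
        show ?thesis
        proof (rule ex1I[of _ j])
          show "j < i \<and> (g j, g i) \<in> parcs G" using j ux g gm True by simp
          fix k assume k: "k < i \<and> (g k, g i) \<in> parcs G"
          then have "f k = u" using uniq[of "f k"] g gm True by (auto simp: U_def)
          then show "k = j" using j k f(1) True by (auto simp: inj_on_def)
        qed
      next
        case False
        then have "i < m" using i by simp
        then have "(j < i \<and> (g j, g i) \<in> parcs G) = (j < i \<and> (f j, f i) \<in> parcs G)" for j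
          using g by auto
        then show ?thesis using f(4) i \<open>i < m\<close> by simp
      qed
      have g_path: "\<exists>p. apath a p b \<and> set (pawalk_verts a p) \<subseteq> insert x U"
        if ab: "a \<in> insert x U" "b \<in> insert x U" for a b
      proof -
        have P: "\<exists>p. apath a p b \<and> set (pawalk_verts a p) \<subseteq> U" if "a \<in> U" "b \<in> U" for a b
          using f(5) that unfolding U_def by blast
        consider "a = x" "b = x" | "a = x" "b \<in> U" | "a \<in> U" "b = x" | "a \<in> U" "b \<in> U"
          using ab by blast
        then show ?thesis
        proof cases
          case 1
          then show ?thesis using ux by (intro exI[of _ "[]"]) (simp add: apath_Nil_iff)
        next
          case 2
          obtain p where "apath u p b" "set (pawalk_verts u p) \<subseteq> U" using P ux 2 by blast
          then show ?thesis
            using 2 ux arcs_sym by (intro exI[of _ "(x, u) # p"]) (auto simp: apath_Cons_iff)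
        next
          case 3
          obtain p where p: "apath a p u" "set (pawalk_verts a p) \<subseteq> U" using P ux 3 by blast
          then have "pawalk_verts a (p @ [(u, x)]) = pawalk_verts a p @ [x]"
            by (induction p arbitrary: a) (auto simp: apath_def awalk_simps)
          with p show ?thesis
            using 3 ux by (intro exI[of _ "p @ [(u, x)]"]) (auto simp: apath_def awalk_simps)
        next
          case 4
          then show ?thesis using P by blast
        qed
      qed
      show ?thesis
      proof (intro exI[of _ g] conjI allI impI ballI)
        show "inj_on g {..<Suc m}" by (fact g_inj)
        show "g ` {..<Suc m} \<subseteq> pverts G" using gU ux f(2) by (auto simp: U_def)
        show "g 0 = r" using False f(3) by (simp add: g_def)
        show "\<exists>!j. j < i \<and> (g j, g i) \<in> parcs G" if "0 < i \<and> i < Suc m" for i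
          using g_ex1 that by blast
        show "\<exists>p. apath a p b \<and> set (pawalk_verts a p) \<subseteq> g ` {..<Suc m}"
          if "a \<in> g ` {..<Suc m}" "b \<in> g ` {..<Suc m}" for a b
          using g_path that unfolding gU .
      qed
    qed
  qed
  moreover have "0 < card (pverts G)" using assms(2) pair_finite_verts card_gt_0_iff by blast
  ultimately obtain f where f: "inj_on f {..<card (pverts G)}"
    "f ` {..<card (pverts G)} \<subseteq> pverts G" "f 0 = r"
    "\<forall>i. 0 < i \<and> i < card (pverts G) \<longrightarrow> (\<exists>!j. j < i \<and> (f j, f i) \<in> parcs G)"
    by blast
  then have "f ` {..<card (pverts G)} = pverts G"
    by (intro card_subset_eq) (auto simp: card_image pair_finite_verts)
  then show ?thesis using that f by (simp add: tree_enum_def bij_betw_def)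
qed

end

section \<open>Trees stable under subdividing two edges\<close>

lemma subdivided_arcs:
  "(Inl u, Inl v) \<in> parcs (subdivided G F) \<longleftrightarrow> (u, v) \<in> parcs G \<and> {u, v} \<notin> F"
  "(Inl u, Inr e) \<in> parcs (subdivided G F) \<longleftrightarrow> e \<in> F \<and> u \<in> e"
  "(Inr e, Inl u) \<in> parcs (subdivided G F) \<longleftrightarrow> e \<in> F \<and> u \<in> e"
  "(Inr e, Inr e') \<notin> parcs (subdivided G F)"
  by (auto simp: subdivided_def)

lemma subdivided_verts: "pverts (subdivided G F) = Inl ` pverts G \<union> Inr ` F"
  by (simp add: subdivided_def)

lemma mem_closed_nbhd_subdivided:
  "Inl u \<in> closed_nbhd (subdivided G F) (Inl v) \<longleftrightarrow> u = v \<or> (v, u) \<in> parcs G \<and> {v, u} \<notin> F"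
  "Inr e \<in> closed_nbhd (subdivided G F) (Inl v) \<longleftrightarrow> e \<in> F \<and> v \<in> e"
  "Inl v \<in> closed_nbhd (subdivided G F) (Inr e) \<longleftrightarrow> e \<in> F \<and> v \<in> e"
  "Inr e' \<in> closed_nbhd (subdivided G F) (Inr e) \<longleftrightarrow> e' = e"
  by (auto simp: mem_closed_nbhd subdivided_arcs)

context pair_graph
begin

lemma edge_mem_edges: "(u, v) \<in> parcs G \<Longrightarrow> {u, v} \<in> edges G"
  by (auto simp: edges_def)

lemma finite_edges: "finite (edges G)"
proof -
  have "edges G = (\<lambda>(u, v). {u, v}) ` parcs G" by (auto simp: edges_def)
  then show ?thesis using pair_finite_arcs by simp
qed

lemma connected_has_neighbour:
  assumes "connected (with_proj G)" "v \<in> pverts G" "2 \<le> card (pverts G)"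
  obtains u where "(v, u) \<in> parcs G"
proof -
  have "pverts G \<noteq> {v}" using assms by auto
  then obtain b where "b \<in> pverts G" "b \<notin> {v}" using assms(2) by blast
  with connected_boundary_arc[OF assms(1), of v "{v}" b] assms(2) that show ?thesis by auto
qed

text \<open>For an uncovered vertex \<open>v\<close> with a neighbour \<open>y\<close>, subdivide \<open>vy\<close> and, if \<open>y\<close> is covered by
  \<open>p \<in> P\<close>, also \<open>yp\<close>: the new vertex on \<open>vy\<close> then extends the packing.\<close>
lemma maximum_packing_covers:
  assumes stable: "stable_under 2 G"
    and conn: "connected (with_proj G)" "2 \<le> card (pverts G)"
    and P: "packing G P" "card P = domination_number G" and v: "v \<in> pverts G"
  obtains p where "p \<in> P" "p \<in> closed_nbhd G v"
proof (rule ccontr)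
  assume "\<not> thesis"
  then have unc: "\<And>p. p \<in> P \<Longrightarrow> p \<noteq> v \<and> (p, v) \<notin> parcs G \<and> (v, p) \<notin> parcs G"
    using that by (auto simp: mem_closed_nbhd dest: arcs_sym)
  obtain y where y: "(v, y) \<in> parcs G" using connected_has_neighbour conn v by blast
  have yP: "y \<notin> P" using unc y by blast
  have vy: "v \<noteq> y" using y no_loops' by blast
  \<comment> \<open>\<open>Q\<close> is empty or a singleton, since \<open>y\<close> lies in at most
    one closed neighbourhood of the packing; taking an image over \<open>Q\<close> treats both cases
    at once.\<close>
  define Q where "Q = {p \<in> P. (p, y) \<in> parcs G}"
  have Q: "\<And>p q. p \<in> Q \<Longrightarrow> q \<in> Q \<Longrightarrow> p = q"
    using packing_unique[OF P(1), of _ _ y] by (auto simp: Q_def mem_closed_nbhd)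
  have cQ: "card Q \<le> 1" "finite Q"
  proof -
    have "Q = {} \<or> (\<exists>q. Q = {q})" using Q by blast
    then show "card Q \<le> 1" "finite Q" by auto
  qed
  define F where "F = insert {v, y} ((\<lambda>p. {p, y}) ` Q)"
  have F: "F \<subseteq> edges G" using y edge_mem_edges by (auto simp: F_def Q_def)
  have "card ((\<lambda>p. {p, y}) ` Q) \<le> 1" using cQ card_image_le order_trans by blast
  then have "card F \<le> 2"
    using card_insert_le_m1[of 2 "(\<lambda>p. {p, y}) ` Q" "{v, y}"] by (simp add: F_def)
  then have le: "domination_number (subdivided G F) \<le> domination_number G"
    using stable F by (auto simp: stable_under_def)
  interpret S: pair_graph "subdivided G F"
    using F by (intro pair_graph_subdivided) (auto intro: pair_graph)
  define P' where "P' = insert (Inr {v, y}) (Inl ` P)"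
  have memF: "e \<in> F \<longleftrightarrow> e = {v, y} \<or> (\<exists>p\<in>Q. e = {p, y})" for e by (auto simp: F_def)
  \<comment> \<open>The new vertex sees only \<open>v\<close> and \<open>y\<close>: no element of
    \<open>P\<close> reaches \<open>v\<close>, and the edges from \<open>P\<close> to
    \<open>y\<close> have all been subdivided.\<close>
  have new: "closed_nbhd (subdivided G F) (Inl q) \<inter> closed_nbhd (subdivided G F) (Inr {v, y}) = {}"
    if q: "q \<in> P" for q
  proof -
    have "w \<notin> closed_nbhd (subdivided G F) (Inl q)"
      if w: "w \<in> closed_nbhd (subdivided G F) (Inr {v, y})" for w
    proof (cases w)
      case (Inl a)
      then have a: "a = v \<or> a = y" using w by (auto simp: mem_closed_nbhd_subdivided)
      have "{q, y} \<in> F" if "(q, y) \<in> parcs G" using that q by (auto simp: memF Q_def)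
      then show ?thesis
        using a unc[OF q] yP q by (auto simp: Inl mem_closed_nbhd_subdivided)
    next
      case (Inr e)
      then have "e = {v, y}" using w by (auto simp: mem_closed_nbhd_subdivided)
      then show ?thesis using unc[OF q] yP q by (auto simp: Inr mem_closed_nbhd_subdivided)
    qed
    then show ?thesis by blast
  qed
  have old: "closed_nbhd (subdivided G F) (Inl q) \<inter> closed_nbhd (subdivided G F) (Inl q') = {}"
    if q: "q \<in> P" "q' \<in> P" "q \<noteq> q'" for q q'
  proof -
    have "w \<notin> closed_nbhd (subdivided G F) (Inl q')"
      if w: "w \<in> closed_nbhd (subdivided G F) (Inl q)" for w
    proof (cases w)
      case (Inl a)
      then have "a \<in> closed_nbhd G q"
        using w by (simp add: Inl mem_closed_nbhd_subdivided) (auto simp: mem_closed_nbhd)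
      then have "a \<notin> closed_nbhd G q'" using packing_unique[OF P(1)] q by blast
      then show ?thesis by (simp add: Inl mem_closed_nbhd_subdivided) (simp add: mem_closed_nbhd)
    next
      case (Inr e)
      then have "e \<in> F" "q \<in> e" using w by (auto simp: mem_closed_nbhd_subdivided)
      \<comment> \<open>Neither \<open>v\<close> nor \<open>y\<close> is in \<open>P\<close>, so
        \<open>e\<close> has at most one end in \<open>P\<close>; hence no two elements of
        \<open>P\<close> share a new vertex.\<close>
      then have "e = {q, y}" using unc q yP by (auto simp: memF)
      then show ?thesis using q yP by (auto simp: Inr mem_closed_nbhd_subdivided)
    qed
    then show ?thesis by blast
  qed
  have "packing (subdivided G F) P'"
    unfolding packing_def
  proof (intro conjI ballI impI)
    show "P' \<subseteq> pverts (subdivided G F)"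
      using P(1) by (auto simp: P'_def subdivided_verts packing_def F_def)
    fix p q assume "p \<in> P'" "q \<in> P'" "p \<noteq> q"
    then consider a where "a \<in> P" "p = Inl a" "q = Inr {v, y}"
      | a where "a \<in> P" "q = Inl a" "p = Inr {v, y}"
      | a b where "a \<in> P" "b \<in> P" "a \<noteq> b" "p = Inl a" "q = Inl b"
      unfolding P'_def by blast
    then show "closed_nbhd (subdivided G F) p \<inter> closed_nbhd (subdivided G F) q = {}"
      by cases (use new old in \<open>simp_all add: Int_commute[of "closed_nbhd _ (Inr {v, y})"]\<close>)
  qed
  then have "card P' \<le> domination_number (subdivided G F)"
    by (rule S.packing_le_domination_number)
  moreover have "finite P"
    using P(1) pair_finite_verts finite_subset unfolding packing_def by blast
  then have "card P' = Suc (card P)"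
    unfolding P'_def by (subst card_insert_disjoint) (auto simp: card_image)
  ultimately show False using le P(2) by simp
qed

text \<open>If a leaf \<open>l\<close> were not in \<open>P\<close>, its neighbour \<open>u\<close> would be, and replacing \<open>u\<close> by \<open>l\<close> would
  give a maximum packing not covering the other neighbours of \<open>u\<close>.\<close>
lemma maximum_packing_two_neighbours:
  assumes stable: "stable_under 2 G"
    and conn: "connected (with_proj G)" "3 \<le> card (pverts G)"
    and P: "packing G P" "card P = domination_number G"
    and l: "l \<in> pverts G" "l \<notin> P"
  shows "\<exists>c. (l, c) \<in> parcs G \<and> c \<noteq> s"
proof (rule ccontr)
  assume contr: "\<not> ?thesis"
  have conn2: "2 \<le> card (pverts G)" using conn by simp
  obtain u where u: "u \<in> P" "u \<in> closed_nbhd G l"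
    using maximum_packing_covers[OF stable conn(1) conn2 P l(1)] .
  then have lu: "(l, u) \<in> parcs G" "u \<noteq> l" using l by (auto simp: mem_closed_nbhd)
  then have ul: "(u, l) \<in> parcs G" using arcs_sym by blast
  \<comment> \<open>The vertex \<open>s\<close> is arbitrary; the negated claim makes all neighbours
    of \<open>l\<close> equal to it, so \<open>l\<close> is a leaf attached to
    \<open>u\<close>.\<close>
  then have only: "c = u" if "(l, c) \<in> parcs G" for c using contr that lu by blast
  define P' where "P' = insert l (P - {u})"
  have fin: "finite P"
    using P(1) pair_finite_verts finite_subset unfolding packing_def by blast
  have sub: "closed_nbhd G l \<subseteq> closed_nbhd G u"
    using only ul by (auto simp: mem_closed_nbhd)
  have "packing G P'"
    unfolding packing_def
  proof (intro conjI ballI impI)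
    show "P' \<subseteq> pverts G" using P(1) l by (auto simp: P'_def packing_def)
    have *: "closed_nbhd G q \<inter> closed_nbhd G l = {}" if "q \<in> P - {u}" for q
      using P(1) u sub that unfolding packing_def by blast
    fix p q assume "p \<in> P'" "q \<in> P'" "p \<noteq> q"
    then show "closed_nbhd G p \<inter> closed_nbhd G q = {}"
      using * P(1) unfolding P'_def packing_def by blast
  qed
  moreover have "card P' = domination_number G"
    unfolding P'_def P(2)[symmetric] card.remove[OF fin u(1)]
    using l(2) fin by (intro card_insert_disjoint) auto
  ultimately have cov: "\<exists>p\<in>P'. p \<in> closed_nbhd G v" if "v \<in> pverts G" for v
    using maximum_packing_covers[OF stable conn(1) conn2 _ _ that] by metis
  have "pverts G \<noteq> {l, u}" using conn(2) lu by auto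
  then obtain b where b: "b \<in> pverts G" "b \<notin> {l, u}" using l(1) lu wellformed' by blast
  \<comment> \<open>An arc leaving \<open>{l, u}\<close> starts at \<open>u\<close>, the only
    neighbour of \<open>l\<close>; it exists because the graph is connected and has a third
    vertex.\<close>
  obtain a z where az: "a \<in> {l, u}" "z \<in> pverts G" "z \<notin> {l, u}" "(a, z) \<in> parcs G"
    using connected_boundary_arc[OF conn(1), of l "{l, u}" b] b l(1) lu wellformed' by blast
  then have uz: "(u, z) \<in> parcs G" using only by auto
  obtain p where p: "p \<in> P'" "p \<in> closed_nbhd G z" using cov az by blast
  have "p \<noteq> l" using p(2) az(3) only arcs_sym[of z l] by (auto simp: mem_closed_nbhd)
  then have "p \<in> P" "p \<noteq> u" using p by (auto simp: P'_def)
  moreover have "z \<in> closed_nbhd G p" using p closed_nbhd_sym by blast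
  moreover have "z \<in> closed_nbhd G u" using uz by (simp add: mem_closed_nbhd)
  ultimately show False using packing_unique[OF P(1) _ u(1)] by blast
qed

text \<open>Root \<open>G\<close> at \<open>x\<close> and let \<open>s\<close> be the element of the perfect code \<open>S\<close> next to \<open>x\<close>. Moving every
  other element of \<open>S\<close> to its parent, and \<open>s\<close> to \<open>x\<close> or to the new vertex on \<open>xs\<close>, gives a
  dominating set of the subdivision.\<close>
lemma subdivide_star_le:
  assumes stable: "stable_under 2 G"
    and conn: "connected (with_proj G)" "3 \<le> card (pverts G)"
    and S: "packing G S" "card S = domination_number G"
    and root: "rooted G x rank par"
    and s: "s \<in> S" "s \<in> closed_nbhd G x" "s = x \<or> s \<in> Y"
    and Y: "\<And>y. y \<in> Y \<Longrightarrow> (x, y) \<in> parcs G"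
  shows "domination_number (subdivided G ((\<lambda>y. {x, y}) ` Y)) \<le> domination_number G"
proof -
  define F where "F = (\<lambda>y. {x, y}) ` Y"
  define c where "c = (if s = x then Inl x else Inr {x, s})"
  define D where "D = insert c (Inl ` par ` (S - {s}))"
  have conn2: "2 \<le> card (pverts G)" using conn by simp
  have xV: "x \<in> pverts G" using root by (simp add: rooted_def)
  have SV: "S \<subseteq> pverts G" using S by (simp add: packing_def)
  have fin: "finite S" using SV pair_finite_verts finite_subset by blast
  have s_only: "t = s" if "t \<in> S" "t \<in> closed_nbhd G x" for t
    using packing_unique[OF S(1) that(1) s(1)] closed_nbhd_sym that s by blast
  have cover: "\<exists>t\<in>S. t \<in> closed_nbhd G v" if "v \<in> pverts G" for v
    using maximum_packing_covers[OF stable conn(1) conn2 S that] by metis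
  have rank_x: "\<not> rank v < rank x" for v using root by (simp add: rooted_def)
  have par_s: "par s = x" if "s \<noteq> x"
    using that s(2) rank_x rooted_cases[OF root, of x s] by (auto simp: mem_closed_nbhd)
  have notin: "s' = t" if "s' \<in> S" "t \<in> S" "(s', t) \<in> parcs G" for s' t
    using packing_unique[OF S(1) that(1,2), of t] that by (auto simp: mem_closed_nbhd)
  have parD: "Inl (par t) \<in> D" if "t \<in> S" "t \<noteq> s" for t using that by (auto simp: D_def)
  have dom: "\<exists>d\<in>D. d \<in> closed_nbhd (subdivided G F) w" if w: "w \<in> pverts (subdivided G F)" for w
  proof -
    \<comment> \<open>A vertex outside the code has a code neighbour \<open>t\<close> above or below
      it. Below, \<open>t\<close> is not \<open>s\<close>, whose parent is \<open>x\<close>, so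
      moving \<open>t\<close> to its parent puts \<open>z\<close> into \<open>D\<close>.\<close>
    have *: thesis
      if z: "z \<in> pverts G" "z \<noteq> x" "z \<notin> S"
      and up: "\<And>t. t \<in> S \<Longrightarrow> (z, t) \<in> parcs G \<Longrightarrow> t = par z \<Longrightarrow> thesis"
      and dn: "Inl z \<in> D \<Longrightarrow> thesis" for z thesis
    proof -
      obtain t where t: "t \<in> S" "(z, t) \<in> parcs G"
        using cover[OF z(1)] z(3) by (auto simp: mem_closed_nbhd)
      show ?thesis
      proof (cases rule: rooted_cases[OF root t(2)])
        case 1
        then have "t \<noteq> s" using par_s z rank_x by auto
        then show ?thesis using dn parD[OF t(1)] 1 by simp
      next
        case 2
        then show ?thesis using up t by blast
      qed
    qed
    have Fz: "{z, z'} \<notin> F" if "z \<noteq> x" "z' \<noteq> x" for z z' using that by (auto simp: F_def)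
    show ?thesis
    proof (cases w)
      case (Inr e)
      then obtain y where y: "y \<in> Y" "e = {x, y}" using w by (auto simp: subdivided_verts F_def)
      then have eF: "e \<in> F" by (auto simp: F_def)
      have xy: "(x, y) \<in> parcs G" "y \<noteq> x" using Y y no_loops' by auto
      have yV: "y \<in> pverts G" using xy wellformed' by blast
      have "par y = x" using rooted_cases[OF root xy(1)] rank_x by metis
      show ?thesis
      proof (cases "s = x \<or> y = s")
        case True
        then have "c \<in> closed_nbhd (subdivided G F) w"
          using Inr y eF xy by (auto simp: c_def mem_closed_nbhd_subdivided)
        then show ?thesis by (auto simp: D_def)
      next
        case False
        \<comment> \<open>Neither \<open>y\<close> nor its parent \<open>x\<close> is in the code,
          so the code neighbour of \<open>y\<close> is a child and has been moved to
          \<open>y\<close>.\<close>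
        have xS: "x \<notin> S" using s_only[of x] False by (auto simp: mem_closed_nbhd)
        have yS: "y \<notin> S" using s_only[of y] False xy by (auto simp: mem_closed_nbhd)
        have "Inl y \<in> D"
          using *[OF yV xy(2) yS] xS \<open>par y = x\<close> by metis
        moreover have "Inl y \<in> closed_nbhd (subdivided G F) w"
          using Inr y eF by (auto simp: mem_closed_nbhd_subdivided)
        ultimately show ?thesis by blast
      qed
    next
      case (Inl z)
      then have zV: "z \<in> pverts G" using w by (auto simp: subdivided_verts)
      have cs: "c \<in> closed_nbhd (subdivided G F) (Inl s)"
        using s by (auto simp: c_def mem_closed_nbhd_subdivided F_def)
      have cx: "c \<in> closed_nbhd (subdivided G F) (Inl x)"
        using s by (auto simp: c_def mem_closed_nbhd_subdivided F_def)
      consider "z = x \<or> z = s" | "z \<in> S" "z \<noteq> x" "z \<noteq> s" | "z \<notin> S" "z \<noteq> x" by blast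
      then show ?thesis
      proof cases
        case 1
        then show ?thesis using cs cx Inl by (auto simp: D_def)
      next
        case 2
        \<comment> \<open>The element \<open>z\<close> was moved to its parent. This is not
          \<open>x\<close>, since \<open>s\<close> is the only code element near \<open>x\<close>,
          so the edge between them is not subdivided.\<close>
        have arc: "(par z, z) \<in> parcs G" using root zV 2 by (auto simp: rooted_def)
        then have "par z \<noteq> x" using s_only[of z] 2 by (auto simp: mem_closed_nbhd)
        then have "Inl (par z) \<in> closed_nbhd (subdivided G F) w"
          using Fz 2 arcs_sym[OF arc] Inl by (auto simp: mem_closed_nbhd_subdivided)
        then show ?thesis using parD 2 by blast
      next
        case 3
        show ?thesis
        proof (rule *[OF zV 3(2,1)])
          assume "Inl z \<in> D"
          then show ?thesis using Inl by (auto simp: mem_closed_nbhd)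
        next
          fix t assume t: "t \<in> S" "(z, t) \<in> parcs G" "t = par z"
          \<comment> \<open>With the code neighbour above \<open>z\<close>, help comes from below.
            As \<open>z\<close> is no leaf, it has a child \<open>d\<close>; neither
            \<open>d\<close> nor \<open>z\<close> is in the code, so the code neighbour of
            \<open>d\<close> is a child of \<open>d\<close> and was moved to
            \<open>d\<close>.\<close>
          obtain d where d: "(z, d) \<in> parcs G" "d \<noteq> t"
            using maximum_packing_two_neighbours[OF stable conn S zV 3(1)] by blast
          have dS: "d \<notin> S"
            using packing_unique[OF S(1) t(1), of d z] t d closed_nbhd_sym
            by (auto simp: mem_closed_nbhd dest: arcs_sym)
          have par_d: "par d = z" "rank z < rank d"
            using rooted_cases[OF root d(1)] d(2) t(3) by metis+
          then have dx: "d \<noteq> x" using rank_x by blast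
          have "d \<in> pverts G" using d wellformed' by blast
          then have "Inl d \<in> D"
            using *[OF _ dx dS] 3(1) par_d by metis
          moreover have "Inl d \<in> closed_nbhd (subdivided G F) w"
            using Fz[OF 3(2) dx] d Inl by (auto simp: mem_closed_nbhd_subdivided)
          ultimately show ?thesis by blast
        qed
      qed
    qed
  qed
  have "D \<subseteq> pverts (subdivided G F)"
  proof -
    have "par t \<in> pverts G" if "t \<in> S" "t \<noteq> s" for t
    proof -
      have "t \<noteq> x" using that s_only[of x] by (auto simp: mem_closed_nbhd)
      then show ?thesis using root that SV wellformed' unfolding rooted_def by blast
    qed
    moreover have "c \<in> pverts (subdivided G F)"
      using s xV by (auto simp: c_def subdivided_verts F_def)
    ultimately show ?thesis by (auto simp: D_def subdivided_verts)
  qed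
  then have "dominating (subdivided G F) D" using dom by (auto simp: dominating_iff)
  then have "domination_number (subdivided G F) \<le> card D" by (rule domination_number_le)
  also have "card D \<le> Suc (card (Inl ` par ` (S - {s}) :: ('a + 'a set) set))"
    unfolding D_def using fin by (simp add: card_insert_if)
  also have "\<dots> \<le> Suc (card (S - {s}))"
    using fin by (simp add: card_image_le image_image)
  also have "\<dots> = card S" by (rule card.remove[OF fin s(1), symmetric])
  finally show ?thesis using S(2) by (simp add: F_def)
qed

text \<open>At a vertex of degree at least three, three edges could be subdivided without raising
  \<gamma>, contrary to \<open>raise\<close>.\<close>

lemma critical_tree_degree_le_2:
  assumes tree: "undirected_tree G" "3 \<le> card (pverts G)"
    and stable: "stable_under 2 G"
    and raise: "\<And>F. F \<subseteq> edges G \<Longrightarrow> card F = 3 \<Longrightarrow>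
      domination_number G < domination_number (subdivided G F)"
    and x: "x \<in> pverts G"
  shows "card {y. (x, y) \<in> parcs G} \<le> 2"
proof (rule ccontr)
  let ?N = "{y. (x, y) \<in> parcs G}"
  assume "\<not> card ?N \<le> 2"
  then have three: "3 \<le> card ?N" by simp
  have conn: "connected (with_proj G)" using tree by (simp add: undirected_tree_def)
  obtain f where f: "tree_enum G f (card (pverts G))" "f 0 = x"
    by (rule undirected_tree_enum[OF tree(1) x])
  then obtain rank par where root: "rooted G x rank par"
    using tree_enum_rooted[OF f(1)] tree(2) by auto
  obtain S where S: "packing G S" "card S = domination_number G"
    using rooted_packing_eq_domination_number[OF root] .
  obtain s where s: "s \<in> S" "s \<in> closed_nbhd G x"
    using maximum_packing_covers[OF stable conn _ S x] tree(2) by auto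
  have "finite ?N"
    using finite_closed_nbhd[OF x] by (simp add: closed_nbhd_def)
  \<comment> \<open>If \<open>s\<close> is not \<open>x\<close>, the edge \<open>xs\<close> has to
    be among the three, because \<open>subdivide_star_le\<close> places the replacement for
    \<open>s\<close> on its new vertex.\<close>
  obtain Y where Y: "Y \<subseteq> ?N" "card Y = 3" "s = x \<or> s \<in> Y"
  proof (cases "s = x")
    case True
    then show ?thesis
      using that obtain_subset_with_card_n[OF three] by metis
  next
    case False
    then have sN: "s \<in> ?N" using s by (auto simp: mem_closed_nbhd)
    then have "2 \<le> card (?N - {s})" using \<open>finite ?N\<close> three by simp
    then obtain Z where Z: "Z \<subseteq> ?N - {s}" "card Z = 2" "finite Z"
      using obtain_subset_with_card_n by metis
    then have "card (insert s Z) = 3" by (subst card_insert_disjoint) auto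
    then show ?thesis using that[of "insert s Z"] Z sN by auto
  qed
  let ?F = "(\<lambda>y. {x, y}) ` Y"
  have "inj_on (\<lambda>y. {x, y}) Y"
    using Y(1) no_loops' by (auto simp: inj_on_def doubleton_eq_iff)
  then have "card ?F = 3" using Y by (simp add: card_image)
  moreover have "?F \<subseteq> edges G" using Y(1) edge_mem_edges by blast
  ultimately have "domination_number G < domination_number (subdivided G ?F)" by (rule raise[rotated])
  moreover have "domination_number (subdivided G ?F) \<le> domination_number G"
    using subdivide_star_le[OF stable conn tree(2) S root s Y(3)] Y(1) by blast
  ultimately show False by simp
qed

end

section \<open>Paths\<close>

text \<open>The inverse of an isomorphism onto \<open>path_graph n\<close>; it lists the vertices in
  their order along the path.\<close>

definition path_enum :: "'a pair_pre_digraph \<Rightarrow> (nat \<Rightarrow> 'a) \<Rightarrow> nat \<Rightarrow> bool" where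
  "path_enum G f n \<longleftrightarrow> bij_betw f {..<n} (pverts G) \<and>
     (\<forall>i<n. \<forall>j<n. (f i, f j) \<in> parcs G \<longleftrightarrow> j = Suc i \<or> i = Suc j)"

text \<open>Applied to the vertices of a path in order, this lists the subdivided path in
  order.\<close>

fun subdivide_list :: "'a set set \<Rightarrow> 'a list \<Rightarrow> ('a + 'a set) list" where
  "subdivide_list F (x # y # xs) =
     (if {x, y} \<in> F then Inl x # Inr {x, y} # subdivide_list F (y # xs)
      else Inl x # subdivide_list F (y # xs))"
| "subdivide_list F xs = map Inl xs"

lemma subdivide_list_Cons: "\<exists>ys. subdivide_list F (x # xs) = Inl x # ys"
  by (cases xs) auto

lemma Inl_set_subdivide_list: "Inl ` set xs \<subseteq> set (subdivide_list F xs)"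
  by (induction F xs rule: subdivide_list.induct) auto

lemma set_subdivide_list_subset: "set (subdivide_list F xs) \<subseteq> Inl ` set xs \<union> Inr ` F"
  by (induction F xs rule: subdivide_list.induct) auto

lemma Inr_set_subdivide_list:
  "Suc i < length xs \<Longrightarrow> {xs ! i, xs ! Suc i} \<in> F \<Longrightarrow>
    Inr {xs ! i, xs ! Suc i} \<in> set (subdivide_list F xs)"
proof (induction F xs arbitrary: i rule: subdivide_list.induct)
  case (1 F x y xs)
  show ?case
  proof (cases i)
    case 0
    then show ?thesis using 1 by simp
  next
    case (Suc j)
    then show ?thesis using 1(1)[of j] 1(2)[of j] 1(3,4) by (cases "{x, y} \<in> F") auto
  qed
qed auto

text \<open>Counting only edges inside \<open>set xs\<close> makes the induction work: by
  distinctness \<open>{x, y}\<close> is not contained in the tail, so it has not been counted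
  there.\<close>

lemma length_subdivide_list:
  "finite F \<Longrightarrow> distinct xs \<Longrightarrow>
    length (subdivide_list F xs) \<le> length xs + card {e \<in> F. e \<subseteq> set xs}"
proof (induction F xs rule: subdivide_list.induct)
  case (1 F x y xs)
  let ?E = "{e \<in> F. e \<subseteq> set (y # xs)}" and ?E' = "{e \<in> F. e \<subseteq> set (x # y # xs)}"
  have fin: "finite ?E'" using 1 by simp
  show ?case
  proof (cases "{x, y} \<in> F")
    case True
    have "{x, y} \<notin> ?E" using 1 by auto
    then have "Suc (card ?E) = card (insert {x, y} ?E)" using 1 by simp
    also have "\<dots> \<le> card ?E'" using True fin by (intro card_mono) auto
    finally show ?thesis using 1 True by simp
  next
    case False
    have "card ?E \<le> card ?E'" using fin by (intro card_mono) auto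
    then show ?thesis using 1 False by simp
  qed
qed auto

lemma successively_subdivide_list:
  "successively (\<lambda>u v. (u, v) \<in> parcs G) xs \<Longrightarrow>
    successively (\<lambda>u v. (u, v) \<in> parcs (subdivided G F)) (subdivide_list F xs)"
proof (induction F xs rule: subdivide_list.induct)
  case (1 F x y xs)
  obtain ys where "subdivide_list F (y # xs) = Inl y # ys" using subdivide_list_Cons by metis
  then show ?case using 1 by (auto simp: subdivided_arcs)
qed auto

section \<open>Domination number of a path and of its subdivisions\<close>

context pair_graph
begin

text \<open>The middle vertex of each block of three dominates the block; a final block of one or
  two vertices still costs one vertex, hence the \<open>2\<close>.\<close>

lemma successively_dominated:
  "successively (\<lambda>u v. (u, v) \<in> parcs G) xs \<Longrightarrow>
    \<exists>D\<subseteq>set xs. 3 * card D \<le> length xs + 2 \<and> (\<forall>v\<in>set xs. closed_nbhd G v \<inter> D \<noteq> {})"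
proof (induction "length xs" arbitrary: xs rule: less_induct)
  case less
  consider "xs = []" | a where "xs = [a]" | a b where "xs = [a, b]"
    | a b c ys where "xs = a # b # c # ys"
    by (metis neq_Nil_conv)
  then show ?case
  proof cases
    case 1
    then show ?thesis by (intro exI[of _ "{}"]) auto
  next
    case (2 a)
    then show ?thesis by (intro exI[of _ "{a}"]) (auto simp: mem_closed_nbhd)
  next
    case (3 a b)
    then show ?thesis using less.prems by (intro exI[of _ "{b}"]) (auto simp: mem_closed_nbhd)
  next
    case (4 a b c ys)
    then have arcs: "(a, b) \<in> parcs G" "(b, c) \<in> parcs G"
      and "successively (\<lambda>u v. (u, v) \<in> parcs G) ys"
      using less.prems by (auto simp: successively_Cons)
    with less.hyps[of ys] 4 obtain D where D: "D \<subseteq> set ys" "3 * card D \<le> length ys + 2"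
      "\<forall>v\<in>set ys. closed_nbhd G v \<inter> D \<noteq> {}"
      by auto
    have "card (insert b D) \<le> Suc (card D)" by (rule card_insert_le_m1) auto
    moreover have "b \<in> closed_nbhd G a" "b \<in> closed_nbhd G b" "b \<in> closed_nbhd G c"
      using arcs arcs_sym by (simp_all add: mem_closed_nbhd)
    ultimately show ?thesis
      using D 4 by (intro exI[of _ "insert b D"]) auto
  qed
qed

lemma domination_number_le_successively:
  assumes "successively (\<lambda>u v. (u, v) \<in> parcs G) xs" "set xs = pverts G"
  shows "3 * domination_number G \<le> length xs + 2"
proof -
  obtain D where "D \<subseteq> set xs" "3 * card D \<le> length xs + 2"
    "\<forall>v\<in>set xs. closed_nbhd G v \<inter> D \<noteq> {}"
    using successively_dominated[OF assms(1)] by blast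
  then show ?thesis
    using domination_number_le[of G D] assms(2) by (simp add: dominating_iff)
qed

text \<open>The closed neighbourhoods of a minimum dominating set cover all vertices and have at
  most three elements each.\<close>

lemma card_verts_le_domination_number:
  assumes "\<And>v. v \<in> pverts G \<Longrightarrow> card {u. (v, u) \<in> parcs G} \<le> 2"
  shows "card (pverts G) \<le> 3 * domination_number G"
proof -
  obtain D where D: "dominating G D" "card D = domination_number G"
    by (rule domination_number_attained)
  have DV: "D \<subseteq> pverts G" using D by (simp add: dominating_def)
  then have fin: "finite D" using pair_finite_verts finite_subset by blast
  have "pverts G \<subseteq> (\<Union>d\<in>D. closed_nbhd G d)"
    using D(1) closed_nbhd_sym unfolding dominating_iff by blast
  then have "card (pverts G) \<le> card (\<Union>d\<in>D. closed_nbhd G d)"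
    using fin DV finite_closed_nbhd by (intro card_mono) auto
  also have "\<dots> \<le> (\<Sum>d\<in>D. card (closed_nbhd G d))" by (rule card_UN_le[OF fin])
  also have "\<dots> \<le> (\<Sum>d\<in>D. 3)"
  proof (rule sum_mono)
    fix d assume "d \<in> D"
    then have "card {u. (d, u) \<in> parcs G} \<le> 2" using assms DV by blast
    then show "card (closed_nbhd G d) \<le> 3"
      unfolding closed_nbhd_def using card_insert_le_m1[of 3 "{u. (d, u) \<in> parcs G}" d] by simp
  qed
  finally show ?thesis using D by simp
qed

text \<open>At an old vertex, each neighbour is kept or replaced by the new vertex on the edge to
  it; a new vertex sees only the ends of its edge.\<close>

lemma subdivided_degree_le_2:
  assumes F: "F \<subseteq> edges G" and deg: "\<And>v. v \<in> pverts G \<Longrightarrow> card {u. (v, u) \<in> parcs G} \<le> 2"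
    and w: "w \<in> pverts (subdivided G F)"
  shows "card {u. (w, u) \<in> parcs (subdivided G F)} \<le> 2"
proof (cases w)
  case (Inl v)
  then have v: "v \<in> pverts G" using w by (auto simp: subdivided_verts)
  let ?N = "{u. (v, u) \<in> parcs G}"
  let ?h = "\<lambda>u. if {v, u} \<in> F then Inr {v, u} else Inl u"
  have "\<exists>u. (v, u) \<in> parcs G \<and> e = {v, u}" if "e \<in> F" "v \<in> e" for e
    using that F arcs_sym unfolding edges_def by blast
  then have "{u. (w, u) \<in> parcs (subdivided G F)} \<subseteq> ?h ` ?N"
    unfolding Inl subdivided_def by force
  moreover have fin: "finite ?N"
    using finite_closed_nbhd[OF v] by (simp add: closed_nbhd_def)
  ultimately have "card {u. (w, u) \<in> parcs (subdivided G F)} \<le> card (?h ` ?N)"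
    by (intro card_mono) auto
  also have "\<dots> \<le> card ?N" using fin by (rule card_image_le)
  finally show ?thesis using deg[OF v] by simp
next
  case (Inr e)
  then have "e \<in> F" using w by (auto simp: subdivided_verts)
  then obtain a b where "e = {a, b}" using F by (auto simp: edges_def)
  then have "{u. (w, u) \<in> parcs (subdivided G F)} \<subseteq> {Inl a, Inl b}"
    unfolding Inr subdivided_def by auto
  then have "card {u. (w, u) \<in> parcs (subdivided G F)} \<le> card {Inl a :: 'a + 'a set, Inl b}"
    by (intro card_mono) auto
  also have "\<dots> \<le> 2" by (simp add: card_insert_if)
  finally show ?thesis .
qed

lemma path_enum_degree_le_2:
  assumes "path_enum G f n" "v \<in> pverts G"
  shows "card {u. (v, u) \<in> parcs G} \<le> 2"
proof -
  have V: "pverts G = f ` {..<n}" using assms by (auto simp: path_enum_def bij_betw_def)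
  then obtain i where i: "i < n" "v = f i" using assms by auto
  \<comment> \<open>At \<open>i = 0\<close> truncated subtraction makes the first entry
    \<open>f 0\<close>, which does no harm in an upper bound.\<close>
  have "{u. (v, u) \<in> parcs G} \<subseteq> {f (i - 1), f (Suc i)}"
  proof
    fix u assume "u \<in> {u. (v, u) \<in> parcs G}"
    then have u: "(v, u) \<in> parcs G" by simp
    then obtain j where "j < n" "u = f j" using wellformed' V by blast
    then have "j = Suc i \<or> i = Suc j" using assms(1) u i by (auto simp: path_enum_def)
    then show "u \<in> {f (i - 1), f (Suc i)}" using \<open>u = f j\<close> by auto
  qed
  then have "card {u. (v, u) \<in> parcs G} \<le> card {f (i - 1), f (Suc i)}"
    by (intro card_mono) auto
  also have "\<dots> \<le> 2" by (simp add: card_insert_if)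
  finally show ?thesis .
qed

lemma path_enum_card: "path_enum G f n \<Longrightarrow> card (pverts G) = n"
  using bij_betw_same_card by (fastforce simp: path_enum_def)

lemma path_enum_successively:
  assumes "path_enum G f n"
  shows "successively (\<lambda>u v. (u, v) \<in> parcs G) (map f [0..<n])"
  using assms by (auto simp: path_enum_def successively_conv_nth)

text \<open>Blocks of three bound \<gamma> above by (n + 2) / 3, degrees bound it below by n / 3,
  and only one integer fits between.\<close>

lemma path_enum_domination_number:
  assumes "path_enum G f n"
  shows "domination_number G = (n + 2) div 3"
proof -
  have "set (map f [0..<n]) = pverts G"
    using assms by (simp add: path_enum_def bij_betw_def atLeast0LessThan)
  then have "3 * domination_number G \<le> n + 2"
    using domination_number_le_successively[OF path_enum_successively[OF assms]] by simp
  moreover have "n \<le> 3 * domination_number G"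
    using card_verts_le_domination_number path_enum_degree_le_2[OF assms] path_enum_card[OF assms]
    by metis
  ultimately show ?thesis by linarith
qed

text \<open>The same two bounds apply: \<open>subdivide_list\<close> gives a walk through all
  vertices of the subdivision, and degrees remain at most two.\<close>

lemma path_enum_domination_number_subdivided:
  assumes f: "path_enum G f n" and F: "F \<subseteq> edges G"
  shows "domination_number (subdivided G F) = (n + card F + 2) div 3"
proof -
  interpret S: pair_graph "subdivided G F"
    using F by (intro pair_graph_subdivided) (auto intro: pair_graph)
  let ?xs = "map f [0..<n]"
  have V: "pverts G = f ` {..<n}" and inj: "inj_on f {..<n}"
    using f by (auto simp: path_enum_def bij_betw_def)
  have finF: "finite F" using F finite_edges finite_subset by blast
  have "Inr e \<in> set (subdivide_list F ?xs)" if e: "e \<in> F" for e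
  proof -
    obtain u v where uv: "e = {u, v}" "(u, v) \<in> parcs G" using e F by (auto simp: edges_def)
    have "u \<in> f ` {..<n}" "v \<in> f ` {..<n}" using wellformed'[OF uv(2)] V by simp_all
    then obtain i j where ij: "i < n" "u = f i" "j < n" "v = f j" by auto
    then have "j = Suc i \<or> i = Suc j" using f uv by (auto simp: path_enum_def)
    then obtain k where k: "Suc k < n" "e = {f k, f (Suc k)}"
      using uv ij by (auto simp: insert_commute)
    then show ?thesis using Inr_set_subdivide_list[of k ?xs F] e by simp
  qed
  moreover have "set ?xs = pverts G" using V by auto
  ultimately have set: "set (subdivide_list F ?xs) = pverts (subdivided G F)"
    using set_subdivide_list_subset[of F ?xs] Inl_set_subdivide_list[of ?xs F]
    unfolding subdivided_verts by blast
  have "distinct ?xs" using inj by (simp add: distinct_map atLeast0LessThan)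
  then have "length (subdivide_list F ?xs) \<le> n + card {e \<in> F. e \<subseteq> set ?xs}"
    using length_subdivide_list[OF finF, of ?xs] by simp
  also have "\<dots> \<le> n + card F" using finF by (simp add: card_mono)
  finally have "3 * domination_number (subdivided G F) \<le> n + card F + 2"
    using S.domination_number_le_successively[OF
        successively_subdivide_list[OF path_enum_successively[OF f]] set] by simp
  moreover have "card (pverts (subdivided G F)) \<le> 3 * domination_number (subdivided G F)"
    using subdivided_degree_le_2[OF F path_enum_degree_le_2[OF f]]
    by (rule S.card_verts_le_domination_number)
  moreover have "card (pverts (subdivided G F)) = n + card F"
    unfolding subdivided_verts using path_enum_card[OF f] finF pair_finite_verts
    by (subst card_Un_disjoint) (auto simp: card_image)
  ultimately show ?thesis by linarith
qed

lemma path_enum_edge_set: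
  assumes "path_enum G f n" "m < n"
  obtains F where "F \<subseteq> edges G" "card F = m"
proof
  \<comment> \<open>The first \<open>m\<close> of the \<open>n - 1\<close> edges along the
    path.\<close>
  let ?F = "(\<lambda>i. {f i, f (Suc i)}) ` {..<m}"
  have inj: "f i = f j \<longleftrightarrow> i = j" if "i < n" "j < n" for i j
    using assms that by (auto simp: path_enum_def bij_betw_def inj_on_def)
  have "inj_on (\<lambda>i. {f i, f (Suc i)}) {..<m}"
    using assms(2) by (auto simp: inj_on_def doubleton_eq_iff inj)
  then show "card ?F = m" by (simp add: card_image)
  show "?F \<subseteq> edges G"
    using assms by (auto simp: path_enum_def intro!: edge_mem_edges)
qed

section \<open>Recognising paths\<close>

lemma digraph_iso_path_graph_iff:
  "digraph_iso (with_proj G) (with_proj (path_graph n)) \<longleftrightarrow> (\<exists>f. path_enum G f n)"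
proof -
  have "pair_wf_digraph G" by unfold_locales
  note iso = digraph_iso_with_proj_iff[OF this, of "path_graph n"]
  have pv: "pverts (path_graph n) = {..<n}" by (simp add: path_graph_def)
  have pa: "(i, j) \<in> parcs (path_graph n) \<longleftrightarrow> i < n \<and> j < n \<and> (j = Suc i \<or> i = Suc j)" for i j
    by (simp add: path_graph_def)
  show ?thesis
  proof
    assume "digraph_iso (with_proj G) (with_proj (path_graph n))"
    then obtain h where h: "bij_betw h (pverts G) {..<n}"
      "map_prod h h ` parcs G = parcs (path_graph n)"
      unfolding iso pv by blast
    define f where "f = inv_into (pverts G) h"
    have f: "bij_betw f {..<n} (pverts G)" using h bij_betw_inv_into by (auto simp: f_def)
    have hf: "h (f i) = i" if "i < n" for i
      using h that by (simp add: f_def bij_betw_inv_into_right)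
    have inj: "inj_on h (pverts G)" using h by (simp add: bij_betw_def)
    have "(f i, f j) \<in> parcs G \<longleftrightarrow> j = Suc i \<or> i = Suc j" if ij: "i < n" "j < n" for i j
    proof -
      have V: "f i \<in> pverts G" "f j \<in> pverts G" using f ij by (auto simp: bij_betw_def)
      have "(f i, f j) \<in> parcs G \<longleftrightarrow> (i, j) \<in> map_prod h h ` parcs G"
      proof
        assume "(f i, f j) \<in> parcs G"
        then show "(i, j) \<in> map_prod h h ` parcs G"
          by (rule rev_image_eqI) (simp add: hf ij)
      next
        assume "(i, j) \<in> map_prod h h ` parcs G"
        then obtain u v where uv: "(u, v) \<in> parcs G" "h u = i" "h v = j" by auto
        then have "u = f i" "v = f j"
          using inj_onD[OF inj, of u "f i"] inj_onD[OF inj, of v "f j"] V hf ij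
            wellformed'[OF uv(1)] by auto
        then show "(f i, f j) \<in> parcs G" using uv by simp
      qed
      then show ?thesis using h(2) pa ij by simp
    qed
    then show "\<exists>f. path_enum G f n" using f unfolding path_enum_def by blast
  next
    assume "\<exists>f. path_enum G f n"
    then obtain f where f: "bij_betw f {..<n} (pverts G)"
      "\<And>i j. i < n \<Longrightarrow> j < n \<Longrightarrow> (f i, f j) \<in> parcs G \<longleftrightarrow> j = Suc i \<or> i = Suc j"
      by (auto simp: path_enum_def)
    define h where "h = inv_into {..<n} f"
    have h: "bij_betw h (pverts G) {..<n}" using f bij_betw_inv_into by (auto simp: h_def)
    have hf: "h (f i) = i" if "i < n" for i
      using f that by (simp add: h_def bij_betw_inv_into_left)
    have V: "pverts G = f ` {..<n}" using f by (simp add: bij_betw_def)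
    have "map_prod h h ` parcs G = parcs (path_graph n)"
    proof (intro equalityI subsetI)
      fix a assume "a \<in> map_prod h h ` parcs G"
      then obtain u v where uv: "(u, v) \<in> parcs G" "a = (h u, h v)" by auto
      obtain i j where ij: "i < n" "u = f i" "j < n" "v = f j"
        using wellformed'[OF uv(1)] V by blast
      then show "a \<in> parcs (path_graph n)" using uv hf f(2) by (simp add: pa)
    next
      fix a assume a: "a \<in> parcs (path_graph n)"
      obtain i j where ij: "a = (i, j)" by (cases a)
      then have "i < n" "j < n" "(f i, f j) \<in> parcs G" using a f(2) pa by auto
      then show "a \<in> map_prod h h ` parcs G"
        using hf ij by (intro rev_image_eqI[of "(f i, f j)"]) auto
    qed
    then show "digraph_iso (with_proj G) (with_proj (path_graph n))"
      unfolding iso pv using h by blast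
  qed
qed

text \<open>All neighbours of the last vertex of an enumeration are earlier, and exactly one earlier
  neighbour exists.\<close>

lemma tree_leaf_exists:
  assumes "undirected_tree G" "2 \<le> card (pverts G)"
  obtains r z where "r \<in> pverts G" "\<And>y. (r, y) \<in> parcs G \<Longrightarrow> y = z"
proof -
  let ?n = "card (pverts G)"
  obtain v where "v \<in> pverts G" using assms by fastforce
  then obtain f where f: "tree_enum G f ?n"
    using undirected_tree_enum[OF assms(1)] by metis
  then have V: "pverts G = f ` {..<?n}" by (auto simp: tree_enum_def bij_betw_def)
  have "\<exists>!j. j < ?n - 1 \<and> (f j, f (?n - 1)) \<in> parcs G"
    using f assms(2) by (auto simp: tree_enum_def)
  then obtain k where k: "\<And>j. j < ?n - 1 \<Longrightarrow> (f j, f (?n - 1)) \<in> parcs G \<Longrightarrow> j = k" by blast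
  have "y = f k" if y: "(f (?n - 1), y) \<in> parcs G" for y
  proof -
    obtain j where j: "j < ?n" "y = f j" using wellformed'[OF y] V by blast
    then have "j \<noteq> ?n - 1" using y no_loops' by blast
    then show ?thesis using k[of j] j arcs_sym[OF y] by simp
  qed
  moreover have "f (?n - 1) \<in> pverts G" using V assms(2) by auto
  ultimately show ?thesis using that by blast
qed

text \<open>Enumerated from a leaf, each vertex attaches to its predecessor: attaching further back
  would give the leaf a second neighbour or an inner vertex a third.\<close>

lemma tree_degree_le_2_path_enum:
  assumes tree: "undirected_tree G" "2 \<le> card (pverts G)"
    and deg: "\<And>x. x \<in> pverts G \<Longrightarrow> card {y. (x, y) \<in> parcs G} \<le> 2"
  obtains f where "path_enum G f (card (pverts G))"
proof -
  let ?n = "card (pverts G)"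
  obtain r z where r: "r \<in> pverts G" "\<And>y. (r, y) \<in> parcs G \<Longrightarrow> y = z"
    using tree_leaf_exists tree by metis
  obtain f where f: "tree_enum G f ?n" "f 0 = r" by (rule undirected_tree_enum[OF tree(1) r(1)])
  have bij: "bij_betw f {..<?n} (pverts G)" using f by (simp add: tree_enum_def)
  then have V: "f i \<in> pverts G" if "i < ?n" for i using that by (auto simp: bij_betw_def)
  have inj: "f i = f j \<longleftrightarrow> i = j" if "i < ?n" "j < ?n" for i j
    using bij that by (auto simp: bij_betw_def inj_on_def)
  have ex1: "\<exists>!j. j < i \<and> (f j, f i) \<in> parcs G" if "0 < i" "i < ?n" for i
    using f that by (auto simp: tree_enum_def)
  have succ: "(f i, f (Suc i)) \<in> parcs G" if "Suc i < ?n" for i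
    using that
  proof (induction i rule: less_induct)
    case (less i)
    obtain j where j: "j < Suc i" "(f j, f (Suc i)) \<in> parcs G" using ex1 less.prems by blast
    have "j = i"
    proof (rule ccontr)
      assume "j \<noteq> i"
      then have ji: "j < i" using j by simp
      then have j': "(f j, f (Suc j)) \<in> parcs G" using less by simp
      show False
      proof (cases j)
        case 0
        then have "f (Suc i) = f (Suc j)" using j j' r(2) f(2) by metis
        then show False using inj less.prems ji by auto
      next
        case (Suc k)
        then have "(f j, f k) \<in> parcs G" using less ji arcs_sym by simp
        then have "{f k, f (Suc j), f (Suc i)} \<subseteq> {y. (f j, y) \<in> parcs G}" using j j' by blast
        moreover have "finite {y. (f j, y) \<in> parcs G}"
          using finite_closed_nbhd[of "f j"] V[of j] ji less.prems by (simp add: closed_nbhd_def)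
        ultimately have "card {f k, f (Suc j), f (Suc i)} \<le> card {y. (f j, y) \<in> parcs G}"
          by (intro card_mono)
        moreover have "card {f k, f (Suc j), f (Suc i)} = 3"
          using inj Suc ji less.prems by simp
        ultimately show False using deg[of "f j"] V[of j] ji less.prems by simp
      qed
    qed
    then show ?case using j by simp
  qed
  \<comment> \<open>No other edges occur, because the unique earlier neighbour of \<open>f j\<close>
    is \<open>f (j - 1)\<close>.\<close>
  have fwd: "j = Suc i" if ij: "i < j" "j < ?n" "(f i, f j) \<in> parcs G" for i j
  proof -
    have "(f (j - 1), f j) \<in> parcs G" using succ[of "j - 1"] ij by simp
    then have "i = j - 1" using ex1[of j] ij by (metis One_nat_def diff_less less_zeroE linorder_neqE_nat zero_less_Suc)
    then show ?thesis using ij by simp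
  qed
  have "(f i, f j) \<in> parcs G \<longleftrightarrow> j = Suc i \<or> i = Suc j" if "i < ?n" "j < ?n" for i j
    using fwd[of i j] fwd[of j i] succ arcs_sym that no_loops'[of "f i" "f j"]
    by (metis linorder_neqE_nat)
  with bij show ?thesis by (intro that[of f]) (simp add: path_enum_def)
qed

end

section \<open>Critical trees\<close>

lemma domination_number_subdivided_le:
  assumes "sd G = q" "F \<subseteq> edges G" "card F < q"
  shows "domination_number (subdivided G F) \<le> domination_number G"
proof (rule ccontr)
  assume "\<not> ?thesis"
  then have "card F \<in> {card F | F. F \<subseteq> edges G \<and>
      domination_number (subdivided G F) > domination_number G}"
    using assms by auto
  then have "sd G \<le> card F" unfolding sd_def by (rule cInf_lower) auto
  then show False using assms by simp
qed

theorem theorem4p5: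
  fixes T :: "'a pair_pre_digraph"
  assumes "undirected_tree T"
    and "card (pverts T) \<ge> 3"
  shows "critical 3 T \<and> sd T = 3 \<longleftrightarrow>
    (\<exists>k::nat. k \<ge> 1 \<and> digraph_iso (with_proj T) (with_proj (path_graph (3 * k + 1))))"
proof -
  interpret pair_graph T using assms(1) by (simp add: undirected_tree_def)
  show ?thesis
  proof
    assume L: "critical 3 T \<and> sd T = 3"
    then have "stable_under 2 T"
      using domination_number_subdivided_le[of T 3] by (auto simp: stable_under_def)
    then have deg: "card {y. (x, y) \<in> parcs T} \<le> 2" if "x \<in> pverts T" for x
      using critical_tree_degree_le_2 assms L that by (auto simp: critical_def)
    define n where "n = card (pverts T)"
    obtain f where f: "path_enum T f n"
      using tree_degree_le_2_path_enum[OF assms(1) _ deg] assms(2) by (auto simp: n_def)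
    obtain F where F: "F \<subseteq> edges T" "card F = 2"
      using path_enum_edge_set[OF f, of 2] assms(2) by (auto simp: n_def)
    \<comment> \<open>By the formula for paths, subdividing two edges leaves \<gamma> unchanged only
      if \<open>n mod 3 = 1\<close>.\<close>
    then have "(n + 2 + 2) div 3 \<le> (n + 2) div 3"
      using domination_number_subdivided_le[of T 3 F] L
        path_enum_domination_number[OF f] path_enum_domination_number_subdivided[OF f F(1)]
      by simp
    then have n: "n = 3 * (n div 3) + 1" by presburger
    have "digraph_iso (with_proj T) (with_proj (path_graph n))"
      using f digraph_iso_path_graph_iff by blast
    moreover have "n div 3 \<ge> 1" using assms(2) by (simp add: n_def)
    ultimately show "\<exists>k\<ge>1. digraph_iso (with_proj T) (with_proj (path_graph (3 * k + 1)))"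
      using n by metis
  next
    assume "\<exists>k. k \<ge> 1 \<and> digraph_iso (with_proj T) (with_proj (path_graph (3 * k + 1)))"
    then obtain k f where k: "k \<ge> 1" and f: "path_enum T f (3 * k + 1)"
      using digraph_iso_path_graph_iff by blast
    have dT: "domination_number T = k + 1"
      using path_enum_domination_number[OF f] by simp
    \<comment> \<open>Since \<open>3 * k + 1 + 2\<close> is a multiple of three, \<gamma> grows only
      with every third subdivided edge.\<close>
    have dF: "domination_number (subdivided T F) = k + 1 + card F div 3" if "F \<subseteq> edges T" for F
      using path_enum_domination_number_subdivided[OF f that] by simp
    obtain F2 where F2: "F2 \<subseteq> edges T" "card F2 = 2" using path_enum_edge_set[OF f, of 2] k by auto
    \<comment> \<open>Three edges exist because \<open>k \<ge> 1\<close> gives at least four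
      vertices.\<close>
    obtain F3 where F3: "F3 \<subseteq> edges T" "card F3 = 3" using path_enum_edge_set[OF f, of 3] k by auto
    have "critical 3 T"
      unfolding critical_def
      using dT dF F2 assms pair_graph by (auto simp: undirected_tree_def intro!: exI[of _ F2])
    moreover have "sd T = 3"
      unfolding sd_def
    proof (rule cInf_eq_minimum)
      show "3 \<in> {card F | F. F \<subseteq> edges T \<and> domination_number (subdivided T F) > domination_number T}"
        using F3 dT dF[OF F3(1)] by force
      fix m assume "m \<in> {card F | F. F \<subseteq> edges T \<and> domination_number (subdivided T F) > domination_number T}"
      then obtain F where "m = card F" "F \<subseteq> edges T"
        "domination_number (subdivided T F) > domination_number T" by blast
      then show "3 \<le> m" using dT dF[of F] by (simp add: div_greater_zero_iff)
    qed
    ultimately show "critical 3 T \<and> sd T = 3" by blast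
  qed
qed

end
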